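(* Let $\psi_h:\mathbb{R}^2\to\mathbb{R}^2$ be the one-step map of a reversible, volume-preserving integrator applied to the standard harmonic oscillator with Hamiltonian $H(q,p)=\frac12(p^2+q^2)$, used with a stable value of $h>0$, so that $\psi_h$ is the linear map with matrix $$\tilde M_h=\begin{bmatrix}\cos\theta_h & \chi_h\sin\theta_h\\ -\chi_h^{-1}\sin\theta_h & \cos\theta_h\end{bmatrix},\qquad \theta_h\in\mathbb{R},\ \chi_h\in\mathbb{R}\setminus\{0\}.$$ Let $I\ge 1$ be an integer, let $\Psi_{h,I}=\psi_h\circ\cdots\circ\psi_h$ ($I$ times), and let $\Delta(q_0,p_0)=H(\Psi_{h,I}(q_0,p_0))-H(q_0,p_0)$ be the energy error after $I$ time-steps. Assume that $(q_0,p_0)$ is a random vector in $\mathbb{R}^2$ with probability density proportional to $\exp(-H(q,p))=\exp\big(-\frac12(p^2+q^2)\big)$. Then the expectation of the random variable $\Delta(q_0,p_0)$ is given by $$\mathbb{E}(\Delta)=\sin^2(I\theta_h)\,\rho(h),$$ where $$\rho(h)=\frac12\left(\chi_h^2+\frac1{\chi_h^2}-2\right)=\frac12\left(\chi_h-\frac1{\chi_h}\right)^2\ge 0,$$ and accordingly $$0\le \mathbb{E}(\Delta)\le\rho(h).$$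
   Context: The equations of motion of the harmonic oscillator are $\frac{d}{dt}q=p$, $\frac{d}{dt}p=-q$. One time-step of length $h>0$ of the integrator is a linear map $(q_{i+1},p_{i+1})^T=\tilde M_h (q_i,p_i)^T$ with $\tilde M_h=\begin{bmatrix}A_h&B_h\\ C_h&D_h\end{bmatrix}$ real. Volume preservation means $\det \tilde M_h=A_hD_h-B_hC_h=1$. Reversibility means $\psi_h^{-1}=S\circ\psi_h\circ S$ with $S(q,p)=(q,-p)$; together with volume preservation this gives $A_h=D_h$. A value of $h$ is stable if either $|A_h|<1$, or $A_h=\pm1$ and $B_h=C_h=0$. For stable $h$ one picks $\theta_h\in\mathbb{R}$ with $A_h=D_h=\cos\theta_h$; if $|A_h|<1$ one defines $\chi_h=B_h/\sin\theta_h$ (which is nonzero), and if $A_h=\pm1$, $B_h=C_h=0$ the matrix has the displayed form for arbitrary nonzero $\chi_h$. *)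

theory Defs
  imports "HOL-Probability.Probability"
begin

text \<open>Phase space is \<open>real ^ 2\<close>: component 1 is the position \<open>q\<close>, component 2 the momentum \<open>p\<close>.\<close>

definition hamiltonian :: "real ^ 2 \<Rightarrow> real" where
  "hamiltonian z = 1 / 2 * ((z $ 2)\<^sup>2 + (z $ 1)\<^sup>2)"

definition momentum_flip :: "real ^ 2 \<Rightarrow> real ^ 2" where
  "momentum_flip z = vector [z $ 1, - (z $ 2)]"

definition reversible :: "(real ^ 2 \<Rightarrow> real ^ 2) \<Rightarrow> bool" where
  "reversible f \<longleftrightarrow> bij f \<and> inv f = momentum_flip \<circ> f \<circ> momentum_flip"

text \<open>Meant for linear maps, where \<open>matrix f\<close> represents \<open>f\<close>; orientation is preserved as well
  (determinant \<open>1\<close>, not \<open>\<plusminus>1\<close>).\<close>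

definition volume_preserving :: "(real ^ 2 \<Rightarrow> real ^ 2) \<Rightarrow> bool" where
  "volume_preserving f \<longleftrightarrow> det (matrix f) = 1"

definition stable_step :: "real ^ 2 ^ 2 \<Rightarrow> bool" where
  "stable_step A \<longleftrightarrow>
     \<bar>A $ 1 $ 1\<bar> < 1 \<or> ((A $ 1 $ 1 = 1 \<or> A $ 1 $ 1 = - 1) \<and> A $ 1 $ 2 = 0 \<and> A $ 2 $ 1 = 0)"

definition energy_error :: "(real ^ 2 \<Rightarrow> real ^ 2) \<Rightarrow> nat \<Rightarrow> real ^ 2 \<Rightarrow> real" where
  "energy_error f I z = hamiltonian ((f ^^ I) z) - hamiltonian z"

text \<open>The argument is the value of \<open>chi h\<close> at the step length considered.\<close>

definition rho :: "real \<Rightarrow> real" where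
  "rho c = 1 / 2 * (c\<^sup>2 + 1 / c\<^sup>2 - 2)"

end

theory Submission imports Defs begin

text \<open>
  Reversibility and unit determinant force the two diagonal entries of the one-step matrix to agree,
  and then stability makes the matrix a rotation by \<open>\<theta>\<close> in the rescaled coordinates
  \<open>(q / \<chi>, p)\<close> (lemmas \<open>reversible_symplectic_diagonal\<close> and \<open>stable_matrix_form\<close>). Iterating it
  therefore only multiplies the angle by the number of steps (\<open>funpow_scaled_rotation\<close>), and the
  energy error is a quadratic form in the initial data: with \<open>s = sin (I \<theta>)\<close> and
  \<open>k = cos (I \<theta>)\<close>,
  \<open>\<Delta> = s\<^sup>2 (1 / \<chi>\<^sup>2 - 1) q\<^sup>2 / 2 + s\<^sup>2 (\<chi>\<^sup>2 - 1) p\<^sup>2 / 2 + s k (\<chi> - 1 / \<chi>) q p\<close>.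

  The initial density is a product of two standard normal densities, so \<open>q\<^sup>2\<close> and \<open>p\<^sup>2\<close> have mean \<open>1\<close> and \<open>q p\<close> has mean \<open>0\<close>
  (\<open>gibbs_expectation_product\<close>). The mixed term averages out, and the other two add up to
  \<open>s\<^sup>2 \<rho>\<close>. The sign of \<open>\<rho>\<close> is that of a square, and the upper bound is \<open>s\<^sup>2 \<le> 1\<close>.
\<close>

section \<open>The one-step matrix and its powers\<close>

text \<open>
  With \<open>A, B, C, D\<close> the entries of the matrix and \<open>S\<close> the flip, reversibility reads
  \<open>(M S)\<^sup>2 = 1\<close>. Its diagonal says \<open>A\<^sup>2 - B C = 1 = D\<^sup>2 - B C\<close>; comparing with
  \<open>A D - B C = 1\<close> gives \<open>A (A - D) = 0 = D (A - D)\<close>, hence \<open>(A - D)\<^sup>2 = 0\<close>.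
\<close>
lemma reversible_symplectic_diagonal:
  fixes f :: "real ^ 2 \<Rightarrow> real ^ 2"
  assumes lin: "linear f" and rev: "reversible f" and vol: "volume_preserving f"
  shows "matrix f $ 2 $ 2 = matrix f $ 1 $ 1"
    and "matrix f $ 1 $ 1 * matrix f $ 1 $ 1 - matrix f $ 1 $ 2 * matrix f $ 2 $ 1 = 1"
proof -
  define A B C D where abcd: "A = matrix f $ 1 $ 1" "B = matrix f $ 1 $ 2"
    "C = matrix f $ 2 $ 1" "D = matrix f $ 2 $ 2"
  have det: "A * D - B * C = 1"
    using vol by (simp add: volume_preserving_def det_2 abcd)
  have comp: "f z $ 1 = A * z $ 1 + B * z $ 2" "f z $ 2 = C * z $ 1 + D * z $ 2" for z
    unfolding abcd fun_cong[OF matrix_vector_mul(2)[OF lin], of z, symmetric]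
    by (simp_all add: matrix_vector_mult_def sum_2)
  have inv: "f (momentum_flip (f (momentum_flip z))) = z" for z
    using rev unfolding reversible_def by (metis bij_inv_eq_iff comp_apply)
  have "A * A - B * C = 1"
    using arg_cong[OF inv[of "vector [1, 0]"], of "\<lambda>v. v $ 1"]
    by (simp add: comp momentum_flip_def)
  moreover have "D * D - B * C = 1"
    using arg_cong[OF inv[of "vector [0, 1]"], of "\<lambda>v. v $ 2"]
    by (simp add: comp momentum_flip_def algebra_simps)
  ultimately have "(A - D)\<^sup>2 = 0"
    using det by (simp add: power2_eq_square algebra_simps)
  then have "D = A"
    by simp
  with det show "matrix f $ 2 $ 2 = matrix f $ 1 $ 1"
    and "matrix f $ 1 $ 1 * matrix f $ 1 $ 1 - matrix f $ 1 $ 2 * matrix f $ 2 $ 1 = 1"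
    by (simp_all add: abcd)
qed

text \<open>
  For \<open>\<bar>A\<bar> < 1\<close> the determinant gives \<open>B C = - sin\<^sup>2 \<theta> \<noteq> 0\<close>, which makes \<open>\<chi> = B / sin \<theta>\<close>
  nonzero and determines \<open>C\<close>. For \<open>\<bar>A\<bar> = 1\<close> both the sine and the off-diagonal entries
  vanish.
\<close>
lemma stable_matrix_form:
  fixes f :: "real ^ 2 \<Rightarrow> real ^ 2" and t x :: real
  assumes "linear f" and "reversible f" and "volume_preserving f"
    and stable: "stable_step (matrix f)"
    and cos: "matrix f $ 1 $ 1 = cos t"
    and inner: "\<bar>matrix f $ 1 $ 1\<bar> < 1 \<Longrightarrow> x = matrix f $ 1 $ 2 / sin t"
    and boundary: "\<bar>matrix f $ 1 $ 1\<bar> = 1 \<Longrightarrow> x \<noteq> 0"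
  shows "x \<noteq> 0"
    and "matrix f = vector [vector [cos t, x * sin t], vector [- inverse x * sin t, cos t]]"
proof -
  note diag = reversible_symplectic_diagonal[OF assms(1-3)]
  have prod: "matrix f $ 1 $ 2 * matrix f $ 2 $ 1 = - (sin t * sin t)"
    using diag(2) sin_cos_squared_add[of t] by (simp add: cos power2_eq_square)
  have main: "x \<noteq> 0 \<and> matrix f $ 1 $ 2 = x * sin t \<and> matrix f $ 2 $ 1 = - inverse x * sin t"
  proof (cases "\<bar>matrix f $ 1 $ 1\<bar> < 1")
    case True
    then have s: "sin t \<noteq> 0"
      using sin_zero_abs_cos_one[of t] by (auto simp: cos)
    with prod have b: "matrix f $ 1 $ 2 \<noteq> 0"
      by auto
    have x: "x = matrix f $ 1 $ 2 / sin t"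
      by (rule inner[OF True])
    show ?thesis
      using s b prod by (simp add: x field_simps)
  next
    case False
    then have A: "\<bar>matrix f $ 1 $ 1\<bar> = 1" and off: "matrix f $ 1 $ 2 = 0" "matrix f $ 2 $ 1 = 0"
      using stable by (auto simp: stable_step_def)
    have "sin t = 0"
      using prod off by simp
    with off boundary[OF A] show ?thesis
      by simp
  qed
  then show "x \<noteq> 0"
    by simp
  show "matrix f = vector [vector [cos t, x * sin t], vector [- inverse x * sin t, cos t]]"
    using main diag(1) by (simp add: vec_eq_iff forall_2 cos)
qed

text \<open>The addition theorems make these matrices a one-parameter group in the angle.\<close>
lemma funpow_scaled_rotation:
  fixes f :: "real ^ 2 \<Rightarrow> real ^ 2" and t x :: real
  assumes x: "x \<noteq> 0"
    and f: "\<And>z. f z $ 1 = cos t * z $ 1 + x * sin t * z $ 2"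
      "\<And>z. f z $ 2 = - inverse x * sin t * z $ 1 + cos t * z $ 2"
  shows "(f ^^ n) z $ 1 = cos (real n * t) * z $ 1 + x * sin (real n * t) * z $ 2 \<and>
    (f ^^ n) z $ 2 = - inverse x * sin (real n * t) * z $ 1 + cos (real n * t) * z $ 2"
proof (induction n)
  case 0
  show ?case by simp
next
  case (Suc n)
  have angle: "real (Suc n) * t = t + real n * t"
    by (simp add: algebra_simps)
  show ?case
    unfolding angle funpow.simps comp_apply f sin_add cos_add
      conjunct1[OF Suc] conjunct2[OF Suc] using x
    by (simp add: algebra_simps)
qed

lemma energy_error_scaled_rotation:
  fixes f :: "real ^ 2 \<Rightarrow> real ^ 2" and t x :: real
  assumes x: "x \<noteq> 0"
    and f: "\<And>z. f z $ 1 = cos t * z $ 1 + x * sin t * z $ 2"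
      "\<And>z. f z $ 2 = - inverse x * sin t * z $ 1 + cos t * z $ 2"
  shows "energy_error f n z =
    1 / 2 * (sin (real n * t))\<^sup>2 * (1 / x\<^sup>2 - 1) * (z $ 1)\<^sup>2
    + 1 / 2 * (sin (real n * t))\<^sup>2 * (x\<^sup>2 - 1) * (z $ 2)\<^sup>2
    + sin (real n * t) * cos (real n * t) * (x - 1 / x) * (z $ 1 * z $ 2)"
proof -
  note iter = funpow_scaled_rotation[where f = f, OF x f, of n z]
  define s k where sk: "s = sin (real n * t)" "k = cos (real n * t)"
  have k2: "k\<^sup>2 = 1 - s\<^sup>2"
    by (simp add: sk cos_squared_eq)
  have "energy_error f n z =
      1 / 2 * ((k\<^sup>2 + s\<^sup>2 / x\<^sup>2) - 1) * (z $ 1)\<^sup>2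
      + 1 / 2 * ((k\<^sup>2 + x\<^sup>2 * s\<^sup>2) - 1) * (z $ 2)\<^sup>2
      + s * k * (x - 1 / x) * (z $ 1 * z $ 2)"
    unfolding energy_error_def hamiltonian_def sk conjunct1[OF iter] conjunct2[OF iter] using x
    by (simp add: power2_eq_square field_simps)
  also have "\<dots> = 1 / 2 * s\<^sup>2 * (1 / x\<^sup>2 - 1) * (z $ 1)\<^sup>2 + 1 / 2 * s\<^sup>2 * (x\<^sup>2 - 1) * (z $ 2)\<^sup>2
      + s * k * (x - 1 / x) * (z $ 1 * z $ 2)"
    unfolding k2 using x by (simp add: field_simps)
  finally show ?thesis
    by (simp add: sk)
qed

lemma rho_eq_square:
  assumes "x \<noteq> 0"
  shows "rho x = 1 / 2 * (x - 1 / x)\<^sup>2"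
  using assms by (simp add: rho_def power2_diff power_divide)

section \<open>Moments of the initial distribution\<close>

text \<open>
  Lebesgue measure on a Euclidean space is the image of the product of the Lebesgue measures along
  the basis vectors, so integrands of product form integrate factor by factor.
\<close>
lemma has_bochner_integral_lborel_vec2:
  fixes u v :: "real \<Rightarrow> real"
  assumes u: "integrable lborel u" and v: "integrable lborel v"
  shows "has_bochner_integral lborel (\<lambda>z :: real ^ 2. u (z $ 1) * v (z $ 2))
    (integral\<^sup>L lborel u * integral\<^sup>L lborel v)"
proof -
  interpret product_sigma_finite "\<lambda>_ :: real ^ 2. lborel :: real measure" ..
  have [measurable]: "u \<in> borel_measurable borel" "v \<in> borel_measurable borel"
    using u v by auto
  define e1 e2 :: "real ^ 2" where e: "e1 = axis 1 1" "e2 = axis 2 1"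
  have ne: "e1 \<noteq> e2"
    by (simp add: e axis_eq_axis)
  have B: "(Basis :: (real ^ 2) set) = {e1, e2}"
    by (auto simp: Basis_vec_def e UNIV_2)
  define g where "g b = (if b = e1 then u else v)" for b
  have g: "integrable lborel (g b)" for b
    using u v by (simp add: g_def)
  let ?P = "\<lambda>w. \<Prod>b\<in>Basis. g b (w b)"
  let ?T = "\<lambda>w :: real ^ 2 \<Rightarrow> real. \<Sum>b\<in>Basis. w b *\<^sub>R b"
  have "integrable (\<Pi>\<^sub>M b\<in>Basis. lborel) ?P"
    "integral\<^sup>L (\<Pi>\<^sub>M b\<in>Basis. lborel) ?P = (\<Prod>b\<in>Basis. integral\<^sup>L lborel (g b))"
    by (rule product_integrable_prod product_integral_prod; simp add: g)+
  then have "has_bochner_integral (\<Pi>\<^sub>M b\<in>Basis. lborel) ?P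
      (integral\<^sup>L lborel u * integral\<^sup>L lborel v)"
    using ne by (simp add: has_bochner_integral_iff B g_def)
  moreover have "?P = (\<lambda>w. u (?T w $ 1) * v (?T w $ 2))"
    using ne by (simp add: B g_def fun_eq_iff) (simp add: e axis_def)
  ultimately have "has_bochner_integral (\<Pi>\<^sub>M b\<in>Basis. lborel)
      (\<lambda>w. u (?T w $ 1) * v (?T w $ 2)) (integral\<^sup>L lborel u * integral\<^sup>L lborel v)"
    by simp
  then show ?thesis
    by (subst lborel_eq)
      (simp add: has_bochner_integral_iff integrable_distr_eq integral_distr)
qed

lemma exp_hamiltonian_eq_normal_densities:
  "exp (- hamiltonian z) = 2 * pi * (std_normal_density (z $ 1) * std_normal_density (z $ 2))"
  by (simp add: hamiltonian_def std_normal_density_def exp_add[symmetric] field_simps)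

text \<open>
  The two components are independent standard normal variables. Only proportionality of the density
  is assumed; since the total mass is \<open>1\<close>, the constant can be only \<open>1 / (2 \<pi>)\<close>. Its sign has
  to be settled first, because \<^const>\<open>ennreal\<close> truncates a negative density to \<open>0\<close>.
\<close>
lemma gibbs_expectation_product:
  fixes M :: "'a measure" and X :: "'a \<Rightarrow> real ^ 2" and u v :: "real \<Rightarrow> real"
  assumes "prob_space M"
    and X: "distributed M lborel X (\<lambda>z. ennreal (c * exp (- hamiltonian z)))"
    and u: "has_bochner_integral lborel (\<lambda>r. std_normal_density r * u r) a"
    and v: "has_bochner_integral lborel (\<lambda>r. std_normal_density r * v r) b"
    and [measurable]: "u \<in> borel_measurable borel" "v \<in> borel_measurable borel"
  shows "has_bochner_integral M (\<lambda>\<omega>. u (X \<omega> $ 1) * v (X \<omega> $ 2)) (a * b)"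
proof -
  interpret prob_space M by fact
  have c: "0 \<le> c"
  proof (rule ccontr)
    assume "\<not> 0 \<le> c"
    then have "c * exp (- hamiltonian z) \<le> 0" for z
      by (simp add: mult_nonpos_nonneg)
    then have "distr M lborel X = density lborel (\<lambda>_. 0)"
      using distributed_distr_eq_density[OF X] by (simp add: ennreal_neg)
    then have "emeasure (distr M lborel X) UNIV = 0"
      by (simp add: emeasure_density)
    moreover have "X \<in> measurable M lborel"
      by (rule distributed_measurable[OF X])
    then have "emeasure (distr M lborel X) UNIV = 1"
      using emeasure_space_1 by (simp add: emeasure_distr)
    ultimately show False
      by simp
  qed
  then have dens: "0 \<le> c * exp (- hamiltonian z)" for z
    by simp
  have transfer: "has_bochner_integral M (\<lambda>\<omega>. u' (X \<omega> $ 1) * v' (X \<omega> $ 2)) (2 * pi * c * (a' * b'))"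
    if u': "has_bochner_integral lborel (\<lambda>r. std_normal_density r * u' r) a'"
      and v': "has_bochner_integral lborel (\<lambda>r. std_normal_density r * v' r) b'"
      and [measurable]: "u' \<in> borel_measurable borel" "v' \<in> borel_measurable borel"
    for u' v' :: "real \<Rightarrow> real" and a' b' :: real
  proof -
    let ?g = "\<lambda>z :: real ^ 2. u' (z $ 1) * v' (z $ 2)"
    have "has_bochner_integral lborel (\<lambda>z :: real ^ 2.
        (std_normal_density (z $ 1) * u' (z $ 1)) * (std_normal_density (z $ 2) * v' (z $ 2))) (a' * b')"
      using has_bochner_integral_lborel_vec2[of "\<lambda>r. std_normal_density r * u' r"
          "\<lambda>r. std_normal_density r * v' r"] u' v'
      by (simp add: has_bochner_integral_iff)
    from has_bochner_integral_mult_right[of "2 * pi * c", OF this]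
    have int: "has_bochner_integral lborel (\<lambda>z. c * exp (- hamiltonian z) * ?g z)
        (2 * pi * c * (a' * b'))"
      by (simp add: exp_hamiltonian_eq_normal_densities mult_ac)
    have "?g \<in> borel_measurable lborel"
      by measurable
    from distributed_integrable[OF X this dens] distributed_integral[OF X this dens] int
    show ?thesis
      by (simp add: has_bochner_integral_iff)
  qed
  have one: "has_bochner_integral lborel (\<lambda>r. std_normal_density r * 1) 1"
    using std_normal_moment_even[of 0] by simp
  \<comment> \<open>The constant function \<open>1\<close> has mean \<open>1\<close>, which fixes the normalisation.\<close>
  have "2 * pi * c = 1"
    using transfer[OF one one] prob_space by (simp add: has_bochner_integral_iff)
  then show ?thesis
    using transfer[OF u v] by simp
qed

theorem proposition3:
  fixes \<psi> :: "real \<Rightarrow> real ^ 2 \<Rightarrow> real ^ 2"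
    and \<theta> chi :: "real \<Rightarrow> real"
    and h c :: real
    and I :: nat
    and M :: "'a measure"
    and X :: "'a \<Rightarrow> real ^ 2"
  assumes "h > 0"
    and "linear (\<psi> h)"
    and "reversible (\<psi> h)"
    and "volume_preserving (\<psi> h)"
    and "stable_step (matrix (\<psi> h))"
    and "matrix (\<psi> h) $ 1 $ 1 = cos (\<theta> h)"
    and "\<bar>matrix (\<psi> h) $ 1 $ 1\<bar> < 1 \<Longrightarrow> chi h = matrix (\<psi> h) $ 1 $ 2 / sin (\<theta> h)"
    and "\<bar>matrix (\<psi> h) $ 1 $ 1\<bar> = 1 \<Longrightarrow> chi h \<noteq> 0"
    and "I \<ge> 1"
    and "prob_space M"
    and "distributed M lborel X (\<lambda>z. ennreal (c * exp (- hamiltonian z)))"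
  shows "chi h \<noteq> 0 \<and>
    matrix (\<psi> h) =
      vector [vector [cos (\<theta> h), chi h * sin (\<theta> h)],
              vector [- inverse (chi h) * sin (\<theta> h), cos (\<theta> h)]] \<and>
    integrable M (\<lambda>\<omega>. energy_error (\<psi> h) I (X \<omega>)) \<and>
    prob_space.expectation M (\<lambda>\<omega>. energy_error (\<psi> h) I (X \<omega>)) =
      (sin (real I * \<theta> h))\<^sup>2 * rho (chi h) \<and>
    rho (chi h) = 1 / 2 * (chi h - 1 / chi h)\<^sup>2 \<and>
    0 \<le> rho (chi h) \<and>
    0 \<le> prob_space.expectation M (\<lambda>\<omega>. energy_error (\<psi> h) I (X \<omega>)) \<and>
    prob_space.expectation M (\<lambda>\<omega>. energy_error (\<psi> h) I (X \<omega>)) \<le> rho (chi h)"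
proof -
  have form: "chi h \<noteq> 0"
    "matrix (\<psi> h) = vector [vector [cos (\<theta> h), chi h * sin (\<theta> h)],
      vector [- inverse (chi h) * sin (\<theta> h), cos (\<theta> h)]]"
    by (rule stable_matrix_form[OF assms(2-6)]; fact assms(7,8))+
  define s k where sk: "s = sin (real I * \<theta> h)" "k = cos (real I * \<theta> h)"
  define E where "E = (\<lambda>\<omega>. energy_error (\<psi> h) I (X \<omega>))"
  have comp: "\<psi> h z $ 1 = cos (\<theta> h) * z $ 1 + chi h * sin (\<theta> h) * z $ 2"
    "\<psi> h z $ 2 = - inverse (chi h) * sin (\<theta> h) * z $ 1 + cos (\<theta> h) * z $ 2" for z
    unfolding fun_cong[OF matrix_vector_mul(2)[OF assms(2)], of z, symmetric]
    unfolding form(2) by (simp_all add: matrix_vector_mult_def sum_2)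
  have one: "has_bochner_integral lborel (\<lambda>r. std_normal_density r * 1) 1"
    and lin: "has_bochner_integral lborel (\<lambda>r. std_normal_density r * r) 0"
    and sq: "has_bochner_integral lborel (\<lambda>r. std_normal_density r * r\<^sup>2) 1"
    using std_normal_moment_even[of 0] std_normal_moment_odd[of 0] std_normal_moment_even[of 1]
    by simp_all
  note moment = gibbs_expectation_product[OF assms(10,11)]
  have q2: "has_bochner_integral M (\<lambda>\<omega>. (X \<omega> $ 1)\<^sup>2) 1"
    using moment[OF sq one] by simp
  have p2: "has_bochner_integral M (\<lambda>\<omega>. (X \<omega> $ 2)\<^sup>2) 1"
    using moment[OF one sq] by simp
  have qp: "has_bochner_integral M (\<lambda>\<omega>. X \<omega> $ 1 * X \<omega> $ 2) 0"
    using moment[OF lin lin] by simp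
  have "has_bochner_integral M E
      (1 / 2 * s\<^sup>2 * (1 / (chi h)\<^sup>2 - 1) * 1 + 1 / 2 * s\<^sup>2 * ((chi h)\<^sup>2 - 1) * 1
        + s * k * (chi h - 1 / chi h) * 0)"
    unfolding E_def energy_error_scaled_rotation[where f = "\<psi> h", OF form(1) comp] sk
    by (intro has_bochner_integral_add has_bochner_integral_mult_right q2 p2 qp)
  also have "1 / 2 * s\<^sup>2 * (1 / (chi h)\<^sup>2 - 1) * 1 + 1 / 2 * s\<^sup>2 * ((chi h)\<^sup>2 - 1) * 1
        + s * k * (chi h - 1 / chi h) * 0 = s\<^sup>2 * rho (chi h)"
    by (simp add: rho_def algebra_simps add_divide_distrib diff_divide_distrib)
  finally have E: "integrable M E" "prob_space.expectation M E = s\<^sup>2 * rho (chi h)"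
    by (simp_all add: has_bochner_integral_iff)
  have nonneg: "0 \<le> rho (chi h)"
    by (simp add: rho_eq_square form(1))
  have "s\<^sup>2 \<le> 1"
    by (simp add: sk abs_square_le_1)
  then have upper: "s\<^sup>2 * rho (chi h) \<le> rho (chi h)"
    using nonneg by (rule mult_left_le_one_le[OF _ zero_le_power2, rotated])
  have mean_nonneg: "0 \<le> s\<^sup>2 * rho (chi h)"
    using nonneg by simp
  show ?thesis
    using form E(1) nonneg upper mean_nonneg rho_eq_square[OF form(1)]
    unfolding E(2)[unfolded E_def sk] E_def sk by blast
qed

end
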